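(* Let $I=[0,1]$. Let $a\in(1,\infty)$ be an irrational number such that $a^k$ is irrational for every positive integer $k$, and let $b\in(0,1)$ be a rational number such that $\frac1a>b$. Let $$H=\{(x,y)\in I\times I : y=ax \text{ or } y=bx\}.$$ Then 1. $H$ is the graph of a surjective upper semicontinuous set-valued function from $I$ to $I$; 2. $H$ is a subcontinuum of $I\times I$; 3. $H$ is almost i-embedded into $I\times I$; that is, $\mathrm{ent}(H)>0$ and exactly one periodic point is generated by $H$.
   Context: A continuum is a nonempty compact connected metric space; a subcontinuum is a subspace that is a continuum. For compact metric spaces $X,Y$, $2^Y$ is the set of nonempty closed subsets of $Y$; a set-valued function from $X$ to $Y$ is a function $F:X\to 2^Y$, with graph $\Gamma(F)=\{(x,y)\in X\times Y : y\in F(x)\}$; it is surjective if $\bigcup_{x\in X}F(x)=Y$. $F$ is upper semicontinuous if for each $x_0\in X$ and each open $U\subseteq Y$ with $F(x_0)\subseteq U$ there is an open $V\ni x_0$ with $F(x)\subseteq U$ for all $x\in V$. A closed relation on a compact metric space $X$ is a closed subset $G\subseteq X\times X$. For a positive integer $m$, $\star_{i=1}^{m}G^{-1}=\{(x_1,\dots,x_{m+1})\in X^{m+1} : (x_{i+1},x_i)\in G \text{ for } i=1,\dots,m\}$, and $\star_{i=1}^{\infty}G^{-1}=\{(x_1,x_2,\dots)\in\prod_{i=1}^\infty X : (x_{i+1},x_i)\in G\text{ for all }i\ge1\}$. The shift map $\sigma$ on $\star_{i=1}^{\infty}G^{-1}$ is $\sigma(x_1,x_2,x_3,\dots)=(x_2,x_3,\dots)$.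 A periodic point generated by $G$ is a point $\mathbf x\in\star_{i=1}^{\infty}G^{-1}$ with $\sigma^n(\mathbf x)=\mathbf x$ for some positive integer $n$. For an open cover $\alpha$ of $X$, $\alpha^{n}=\{A_1\times\dots\times A_n : A_j\in\alpha\}$, and for closed $K\subseteq X^n$, $N(K,\alpha^n)$ is the minimal cardinality of a subfamily of $\alpha^n$ whose union contains $K$. For $G\ne\emptyset$, $\mathrm{ent}(G,\alpha)=\lim_{m\to\infty}\frac{1}{m}\log N(\star_{i=1}^mG^{-1},\alpha^{m+1})$ (convention: $\log 0:=0$, relevant only if a Mahavier product is empty; the limit exists). The entropy is $\mathrm{ent}(G)=\sup_\alpha\mathrm{ent}(G,\alpha)\in[0,\infty]$ over all open covers $\alpha$ of $X$ if $G\neq\emptyset$, and $\mathrm{ent}(\emptyset)=0$. $G$ is almost i-embedded into $X\times X$ if $\mathrm{ent}(G)>0$ and exactly one periodic point is generated by $G$. *)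

theory Defs
  imports "HOL-Analysis.Analysis"
begin

text \<open>
  Compact metric spaces are represented as subsets of an ambient metric type; ``open'' and
  ``closed'' always refer to the subspace topology \<^term>\<open>top_of_set X\<close>.
\<close>

definition continuum :: "'a::metric_space set \<Rightarrow> bool" where
  "continuum S \<longleftrightarrow> S \<noteq> {} \<and> compact S \<and> connected S"

definition subcontinuum :: "'a::metric_space set \<Rightarrow> 'a set \<Rightarrow> bool" where
  "subcontinuum S T \<longleftrightarrow> S \<subseteq> T \<and> continuum S"

definition hyperspace :: "'b::metric_space set \<Rightarrow> 'b set set" where
  "hyperspace Y = {A. A \<noteq> {} \<and> closedin (top_of_set Y) A}"

text \<open>
  A set-valued function from \<open>X\<close> to \<open>Y\<close> is an element of \<^term>\<open>X \<rightarrow> hyperspace Y\<close>; its values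
  outside \<open>X\<close> are irrelevant to all notions below.
\<close>

definition sv_graph :: "'a set \<Rightarrow> 'b set \<Rightarrow> ('a \<Rightarrow> 'b set) \<Rightarrow> ('a \<times> 'b) set" where
  "sv_graph X Y F = {(x, y) \<in> X \<times> Y. y \<in> F x}"

definition sv_surjective :: "'a set \<Rightarrow> 'b set \<Rightarrow> ('a \<Rightarrow> 'b set) \<Rightarrow> bool" where
  "sv_surjective X Y F \<longleftrightarrow> (\<Union>x\<in>X. F x) = Y"

definition upper_semicontinuous ::
    "'a::metric_space set \<Rightarrow> 'b::metric_space set \<Rightarrow> ('a \<Rightarrow> 'b set) \<Rightarrow> bool" where
  "upper_semicontinuous X Y F \<longleftrightarrow>
     (\<forall>x0\<in>X. \<forall>U. openin (top_of_set Y) U \<and> F x0 \<subseteq> U \<longrightarrow>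
        (\<exists>V. openin (top_of_set X) V \<and> x0 \<in> V \<and> (\<forall>x\<in>V. F x \<subseteq> U)))"

definition closed_relation :: "'a::metric_space set \<Rightarrow> ('a \<times> 'a) set \<Rightarrow> bool" where
  "closed_relation X G \<longleftrightarrow> closedin (top_of_set (X \<times> X)) G"

text \<open>
  Coordinates are numbered from \<open>0\<close>. The power \<open>X\<^sup>n\<close> is the extensional function space
  \<^term>\<open>{..<n} \<rightarrow>\<^sub>E X\<close>. Both products below are those of the inverse relation of \<open>G\<close>.
\<close>

definition mahavier :: "'a set \<Rightarrow> ('a \<times> 'a) set \<Rightarrow> nat \<Rightarrow> (nat \<Rightarrow> 'a) set" where
  "mahavier X G m = {x \<in> {..<m + 1} \<rightarrow>\<^sub>E X. \<forall>i<m. (x (Suc i), x i) \<in> G}"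

definition mahavier_inf :: "'a set \<Rightarrow> ('a \<times> 'a) set \<Rightarrow> (nat \<Rightarrow> 'a) set" where
  "mahavier_inf X G = {x \<in> UNIV \<rightarrow> X. \<forall>i. (x (Suc i), x i) \<in> G}"

definition shift :: "(nat \<Rightarrow> 'a) \<Rightarrow> (nat \<Rightarrow> 'a)" where
  "shift x = (\<lambda>i. x (Suc i))"

definition periodic_point :: "'a set \<Rightarrow> ('a \<times> 'a) set \<Rightarrow> (nat \<Rightarrow> 'a) \<Rightarrow> bool" where
  "periodic_point X G x \<longleftrightarrow> x \<in> mahavier_inf X G \<and> (\<exists>n>0. (shift ^^ n) x = x)"

definition open_cover :: "'a::metric_space set \<Rightarrow> 'a set set \<Rightarrow> bool" where
  "open_cover X \<alpha> \<longleftrightarrow> (\<forall>A\<in>\<alpha>. openin (top_of_set X) A) \<and> \<Union>\<alpha> = X"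

definition cover_power :: "'a set set \<Rightarrow> nat \<Rightarrow> (nat \<Rightarrow> 'a) set set" where
  "cover_power \<alpha> n = {Pi\<^sub>E {..<n} A |A. \<forall>j<n. A j \<in> \<alpha>}"

text \<open>
  For compact \<open>K\<close> the minimum is attained by a finite subfamily, so only those are considered.
\<close>

definition cover_number :: "(nat \<Rightarrow> 'a) set \<Rightarrow> (nat \<Rightarrow> 'a) set set \<Rightarrow> nat" where
  "cover_number K \<B> = (LEAST k. \<exists>\<C>\<subseteq>\<B>. finite \<C> \<and> card \<C> = k \<and> K \<subseteq> \<Union>\<C>)"

text \<open>The logarithm with the convention that \<open>log 0 = 0\<close>.\<close>

definition log0 :: "nat \<Rightarrow> real" where
  "log0 k = (if k = 0 then 0 else ln (real k))"

definition ent_cover :: "'a set \<Rightarrow> ('a \<times> 'a) set \<Rightarrow> 'a set set \<Rightarrow> real" where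
  "ent_cover X G \<alpha> =
     lim (\<lambda>m. 1 / real m * log0 (cover_number (mahavier X G m) (cover_power \<alpha> (m + 1))))"

definition ent :: "'a::metric_space set \<Rightarrow> ('a \<times> 'a) set \<Rightarrow> ereal" where
  "ent X G = (if G = {} then 0 else SUP \<alpha>\<in>{\<alpha>. open_cover X \<alpha>}. ereal (ent_cover X G \<alpha>))"

definition almost_i_embedded :: "'a::metric_space set \<Rightarrow> ('a \<times> 'a) set \<Rightarrow> bool" where
  "almost_i_embedded X G \<longleftrightarrow>
     closed_relation X G \<and> ent X G > 0 \<and> (\<exists>!x. periodic_point X G x)"

end

theory Submission
  imports Defs
begin

text \<open>
  Only the positivity of the entropy needs work. Read backwards, a point of a Mahavier product is
  a finite orbit in which every step multiplies by \<open>a\<close> or by \<open>b\<close> and stays in \<open>[0,1]\<close>. Follow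
  the orbit of \<open>1/a\<close> under the rule ``multiply by \<open>b\<close> above \<open>1/a\<^sup>2\<close>, by \<open>a\<close> otherwise''. It stays
  in \<open>[b/a\<^sup>2, 1/a]\<close>. As \<open>a b < 1\<close>, a multiplication by \<open>b\<close> leads from \<open>z\<close> to
  \<open>b z \<le> b/a < 1/a\<^sup>2\<close>, so it is followed by a multiplication by \<open>a\<close>. The two
  multiplications commute and \<open>a z \<le> 1\<close>, so \<open>z, b z, a b z\<close> may be replaced by \<open>z, a z, a b z\<close>,
  and this can be done independently at each of the times, called peaks below, at which the orbit
  exceeds \<open>1/a\<^sup>2\<close>. Being bounded away from \<open>0\<close>, the orbit has peaks with bounded gaps. Since
  \<open>b z \<le> b/a < 1/a < a z\<close> at a peak, the cover of \<open>[0,1]\<close> by \<open>{x. x < 1/a}\<close> and \<open>{x. b/a < x}\<close>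
  tells the two alternatives apart, so covering the Mahavier product takes at least \<open>2\<^sup>p\<close> boxes,
  where \<open>p\<close> is the number of peaks; hence the covering numbers grow exponentially. That their
  growth rate is an actual limit follows from submultiplicativity and Fekete's lemma.

  A periodic point of period \<open>n\<close> with a nonzero coordinate would give \<open>a\<^sup>i b\<^sup>j = 1\<close> with
  \<open>i + j = n\<close>. Here \<open>i > 0\<close> since \<open>b < 1\<close>, so \<open>a\<^sup>i = b\<^sup>-\<^sup>j\<close> would be a rational positive power of
  \<open>a\<close>. Thus the zero sequence is the only periodic point.
\<close>

section \<open>Fekete's subadditive lemma\<close>

text \<open>
  Division with remainder by \<open>k\<close> gives \<open>f m / m \<le> f k / k + M / m\<close> for a constant \<open>M\<close>
  depending on \<open>k\<close>, so the averages converge to their infimum.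
\<close>

lemma subadditive_averages_convergent:
  fixes f :: "nat \<Rightarrow> real"
  assumes sub: "\<And>m n. f (m + n) \<le> f m + f n" and nonneg: "\<And>n. 0 \<le> f n"
  shows "convergent (\<lambda>n. f n / real n)"
proof -
  define L where "L = (INF k\<in>{1..}. f k / real k)"
  have bdd: "bdd_below ((\<lambda>k. f k / real k) ` {1..})"
    using nonneg by (intro bdd_belowI[of _ 0]) auto
  have lower: "L \<le> f n / real n" if "n \<ge> 1" for n
    unfolding L_def using that bdd by (intro cINF_lower) auto
  have mult: "f (q * k + r) \<le> real q * f k + f r" for q k r
  proof (induction q)
    case (Suc q)
    have "f (Suc q * k + r) \<le> f k + f (q * k + r)"
      using sub[of k "q * k + r"] by (simp add: algebra_simps)
    with Suc show ?case by (simp add: algebra_simps)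
  qed simp
  have "(\<lambda>n. f n / real n) \<longlonglongrightarrow> L"
  proof (rule LIMSEQ_I)
    fix e :: real assume "e > 0"
    then have "\<exists>k\<in>{1..}. f k / real k < L + e / 2"
      using bdd unfolding L_def by (subst cINF_less_iff[symmetric]) auto
    then obtain k where k: "k \<ge> 1" "f k / real k < L + e / 2" by auto
    define M where "M = (\<Sum>r<k. f r)"
    have M: "f r \<le> M" if "r < k" for r
      unfolding M_def using that nonneg by (intro member_le_sum) auto
    obtain n0 where n0: "real n0 > 2 * M / e"
      using reals_Archimedean2 by blast
    show "\<exists>no. \<forall>n\<ge>no. norm (f n / real n - L) < e"
    proof (intro exI allI impI)
      fix n assume n: "n \<ge> max 1 n0"
      have "f n \<le> real (n div k) * f k + f (n mod k)"
        using mult[of "n div k" k "n mod k"] by simp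
      also have "\<dots> \<le> real (n div k) * f k + M"
        using M[of "n mod k"] k(1) by simp
      finally have "f n \<le> real (n div k) * real k * (f k / real k) + M"
        using k(1) by simp
      moreover have "real (n div k) * real k \<le> real n"
        by (metis of_nat_mono of_nat_mult div_times_less_eq_dividend)
      then have "real (n div k) * real k * (f k / real k) \<le> real n * (f k / real k)"
        using nonneg[of k] by (intro mult_right_mono) auto
      ultimately have "f n \<le> real n * (f k / real k) + M" by linarith
      moreover have "M < real n * (e / 2)"
      proof -
        have "2 * M / e < real n" using n0 n by (meson less_le_trans max.boundedE of_nat_mono)
        with \<open>e > 0\<close> show ?thesis by (simp add: field_simps)
      qed
      moreover have "real n * (f k / real k) \<le> real n * (L + e / 2)"
        using k(2) by (intro mult_left_mono) auto
      ultimately have "f n < real n * (L + e)" by (simp add: algebra_simps)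
      then have "f n / real n < L + e"
        using n by (simp add: field_simps)
      with lower[of n] n \<open>e > 0\<close> show "norm (f n / real n - L) < e" by simp
    qed
  qed
  then show ?thesis by (rule convergentI)
qed

section \<open>Covering numbers of Mahavier products\<close>

lemma cover_number_le_card:
  assumes "\<C> \<subseteq> \<B>" "finite \<C>" "K \<subseteq> \<Union>\<C>"
  shows "cover_number K \<B> \<le> card \<C>"
  unfolding cover_number_def by (rule Least_le) (use assms in blast)

lemma cover_number_attained:
  assumes "finite \<B>" "K \<subseteq> \<Union>\<B>"
  obtains \<C> where "\<C> \<subseteq> \<B>" "finite \<C>" "card \<C> = cover_number K \<B>" "K \<subseteq> \<Union>\<C>"
proof -
  have "\<exists>k. \<exists>\<C>\<subseteq>\<B>. finite \<C> \<and> card \<C> = k \<and> K \<subseteq> \<Union>\<C>"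
    using assms by blast
  from LeastI_ex[OF this] show thesis
    unfolding cover_number_def[symmetric] using that by blast
qed

text \<open>Points no two of which share a member of the cover need one member each.\<close>

lemma card_le_cover_number:
  assumes "finite \<B>" "K \<subseteq> \<Union>\<B>" and in_K: "\<And>s. s \<in> S \<Longrightarrow> p s \<in> K"
    and separated: "\<And>B s t. B \<in> \<B> \<Longrightarrow> s \<in> S \<Longrightarrow> t \<in> S \<Longrightarrow> p s \<in> B \<Longrightarrow> p t \<in> B \<Longrightarrow> s = t"
  shows "card S \<le> cover_number K \<B>"
proof -
  obtain \<C> where \<C>: "\<C> \<subseteq> \<B>" "finite \<C>" "card \<C> = cover_number K \<B>" "K \<subseteq> \<Union>\<C>"
    using assms(1,2) by (rule cover_number_attained)
  have "\<forall>s\<in>S. \<exists>C\<in>\<C>. p s \<in> C" using in_K \<C>(4) by blast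
  then obtain c where c: "\<And>s. s \<in> S \<Longrightarrow> c s \<in> \<C> \<and> p s \<in> c s" by metis
  then have "inj_on c S"
    using separated \<C>(1) by (metis inj_onI subsetD)
  moreover have "c ` S \<subseteq> \<C>" using c by blast
  ultimately have "card S \<le> card \<C>" using \<C>(2) by (rule card_inj_on_le)
  with \<C>(3) show ?thesis by simp
qed

lemma finite_cover_power:
  assumes "finite \<alpha>"
  shows "finite (cover_power \<alpha> n)"
proof (rule finite_subset)
  show "cover_power \<alpha> n \<subseteq> Pi\<^sub>E {..<n} ` ({..<n} \<rightarrow>\<^sub>E \<alpha>)"
  proof
    fix B assume "B \<in> cover_power \<alpha> n"
    then obtain A where A: "B = Pi\<^sub>E {..<n} A" "\<forall>j<n. A j \<in> \<alpha>"
      unfolding cover_power_def by blast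
    have "B = Pi\<^sub>E {..<n} (restrict A {..<n})"
      unfolding A(1) by (rule PiE_cong) simp
    moreover have "restrict A {..<n} \<in> {..<n} \<rightarrow>\<^sub>E \<alpha>" using A(2) by simp
    ultimately show "B \<in> Pi\<^sub>E {..<n} ` ({..<n} \<rightarrow>\<^sub>E \<alpha>)" by blast
  qed
  show "finite (Pi\<^sub>E {..<n} ` ({..<n} \<rightarrow>\<^sub>E \<alpha>))"
    using assms by (intro finite_imageI finite_PiE) auto
qed

lemma mahavier_subset_Union_cover_power:
  assumes "\<Union>\<alpha> = X"
  shows "mahavier X G m \<subseteq> \<Union>(cover_power \<alpha> (m + 1))"
proof
  fix x assume "x \<in> mahavier X G m"
  then have x: "x \<in> {..<m + 1} \<rightarrow>\<^sub>E X" by (simp add: mahavier_def)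
  have "\<forall>j<m + 1. \<exists>B\<in>\<alpha>. x j \<in> B"
    using PiE_mem[OF x] assms by (metis UnionE lessThan_iff)
  then obtain A where A: "\<And>j. j < m + 1 \<Longrightarrow> A j \<in> \<alpha> \<and> x j \<in> A j" by metis
  have "x \<in> Pi\<^sub>E {..<m + 1} A"
    using x A by (auto simp: PiE_iff)
  then show "x \<in> \<Union>(cover_power \<alpha> (m + 1))"
    using A unfolding cover_power_def by blast
qed

text \<open>
  A point of the product of length \<open>m + n\<close> consists of one of length \<open>m\<close> and one of length \<open>n\<close>
  that share the coordinate \<open>m\<close>. Gluing boxes, with the first box deciding about the shared
  coordinate, turns two covers into one.
\<close>

lemma cover_number_mahavier_submultiplicative:
  fixes X :: "'a set" and G :: "('a \<times> 'a) set"
  assumes fin: "finite \<alpha>" and cov: "\<Union>\<alpha> = X"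
  defines "N \<equiv> (\<lambda>m. cover_number (mahavier X G m) (cover_power \<alpha> (m + 1)))"
  shows "N (m + n) \<le> N m * N n"
proof -
  obtain \<C> where \<C>: "\<C> \<subseteq> cover_power \<alpha> (m + 1)" "finite \<C>" "card \<C> = N m"
      "mahavier X G m \<subseteq> \<Union>\<C>"
    unfolding N_def
    by (rule cover_number_attained[OF finite_cover_power[OF fin]
          mahavier_subset_Union_cover_power[OF cov]])
  obtain \<D> where \<D>: "\<D> \<subseteq> cover_power \<alpha> (n + 1)" "finite \<D>" "card \<D> = N n"
      "mahavier X G n \<subseteq> \<Union>\<D>"
    unfolding N_def
    by (rule cover_number_attained[OF finite_cover_power[OF fin]
          mahavier_subset_Union_cover_power[OF cov]])
  define sides :: "nat \<Rightarrow> (nat \<Rightarrow> 'a) set \<Rightarrow> nat \<Rightarrow> 'a set"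
    where "sides = (\<lambda>k C. SOME A. C = Pi\<^sub>E {..<k} A \<and> (\<forall>j<k. A j \<in> \<alpha>))"
  have sides: "C = Pi\<^sub>E {..<k} (sides k C) \<and> (\<forall>j<k. sides k C j \<in> \<alpha>)"
    if "C \<in> cover_power \<alpha> k" for k C
  proof -
    from that have "\<exists>A. C = Pi\<^sub>E {..<k} A \<and> (\<forall>j<k. A j \<in> \<alpha>)"
      unfolding cover_power_def by blast
    from someI_ex[OF this] show ?thesis unfolding sides_def .
  qed
  define glue where "glue = (\<lambda>(C, D). Pi\<^sub>E {..<m + n + 1}
      (\<lambda>j. if j < m + 1 then sides (m + 1) C j else sides (n + 1) D (j - m)))"
  have "N (m + n) \<le> card (glue ` (\<C> \<times> \<D>))"
    unfolding N_def
  proof (rule cover_number_le_card)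
    show "glue ` (\<C> \<times> \<D>) \<subseteq> cover_power \<alpha> (m + n + 1)"
    proof clarify
      fix C D assume "C \<in> \<C>" "D \<in> \<D>"
      then have "C \<in> cover_power \<alpha> (m + 1)" "D \<in> cover_power \<alpha> (n + 1)"
        using \<C>(1) \<D>(1) by auto
      then have "\<forall>j<m + 1. sides (m + 1) C j \<in> \<alpha>" "\<forall>j<n + 1. sides (n + 1) D j \<in> \<alpha>"
        using sides by blast+
      then have "\<forall>j<m + n + 1.
          (if j < m + 1 then sides (m + 1) C j else sides (n + 1) D (j - m)) \<in> \<alpha>"
        by auto
      then show "glue (C, D) \<in> cover_power \<alpha> (m + n + 1)"
        unfolding glue_def cover_power_def prod.case by blast
    qed
    show "finite (glue ` (\<C> \<times> \<D>))" using \<C>(2) \<D>(2) by simp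
    show "mahavier X G (m + n) \<subseteq> \<Union>(glue ` (\<C> \<times> \<D>))"
    proof
      fix x assume x: "x \<in> mahavier X G (m + n)"
      let ?y = "restrict x {..<m + 1}" and ?z = "restrict (\<lambda>i. x (m + i)) {..<n + 1}"
      have x_ext: "x \<in> {..<m + n + 1} \<rightarrow>\<^sub>E X" using x by (simp add: mahavier_def)
      have "?y \<in> mahavier X G m" "?z \<in> mahavier X G n"
        using x by (auto simp: mahavier_def PiE_iff)
      then obtain C D where CD: "C \<in> \<C>" "?y \<in> C" "D \<in> \<D>" "?z \<in> D"
        using \<C>(4) \<D>(4) by blast
      have C: "C = Pi\<^sub>E {..<m + 1} (sides (m + 1) C)"
        and D: "D = Pi\<^sub>E {..<n + 1} (sides (n + 1) D)"
        using sides CD \<C>(1) \<D>(1) by blast+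
      have y: "x j \<in> sides (m + 1) C j" if "j < m + 1" for j
        using PiE_mem[OF subsetD[OF equalityD1[OF C] CD(2)], of j] that by simp
      have z: "x (m + j) \<in> sides (n + 1) D j" if "j < n + 1" for j
        using PiE_mem[OF subsetD[OF equalityD1[OF D] CD(4)], of j] that by simp
      have "x \<in> glue (C, D)"
        unfolding glue_def prod.case
      proof (rule PiE_I)
        fix j assume "j \<in> {..<m + n + 1}"
        then show "x j \<in> (if j < m + 1 then sides (m + 1) C j else sides (n + 1) D (j - m))"
          using y[of j] z[of "j - m"] by auto
      next
        fix j assume "j \<notin> {..<m + n + 1}"
        then show "x j = undefined" using x_ext by (simp add: PiE_iff extensional_def)
      qed
      with CD show "x \<in> \<Union>(glue ` (\<C> \<times> \<D>))" by blast
    qed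
  qed
  also have "\<dots> \<le> card (\<C> \<times> \<D>)"
    using \<C>(2) \<D>(2) by (intro card_image_le) simp
  also have "\<dots> = N m * N n" by (simp add: card_cartesian_product \<C>(3) \<D>(3))
  finally show ?thesis .
qed

lemma log0_nonneg: "0 \<le> log0 k"
  by (simp add: log0_def)

lemma log0_mono: "k \<le> l \<Longrightarrow> log0 k \<le> log0 l"
  by (simp add: log0_def)

lemma log0_mult_le: "log0 (k * l) \<le> log0 k + log0 l"
  by (simp add: log0_def ln_mult)

lemma ent_cover_tendsto:
  assumes "finite \<alpha>" "\<Union>\<alpha> = X"
  shows "(\<lambda>m. 1 / real m * log0 (cover_number (mahavier X G m) (cover_power \<alpha> (m + 1))))
           \<longlonglongrightarrow> ent_cover X G \<alpha>"
proof -
  let ?f = "\<lambda>m. log0 (cover_number (mahavier X G m) (cover_power \<alpha> (m + 1)))"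
  have "convergent (\<lambda>m. ?f m / real m)"
  proof (rule subadditive_averages_convergent)
    show "?f (m + n) \<le> ?f m + ?f n" for m n
      using log0_mono[OF cover_number_mahavier_submultiplicative[OF assms]] log0_mult_le
      by (rule order_trans)
  qed (rule log0_nonneg)
  then show ?thesis
    unfolding ent_cover_def by (simp add: convergent_LIMSEQ_iff)
qed

text \<open>
  If in every \<open>K\<close> steps the covering number at least doubles, the entropy is at least
  \<open>ln 2 / (2 K)\<close>; the factor \<open>2\<close> absorbs the rounding in \<open>m div K\<close>.
\<close>

lemma ent_pos_if_exponential_growth:
  assumes "open_cover X \<alpha>" "finite \<alpha>" "G \<noteq> {}" "K > 0"
    and growth: "\<And>m. 2 ^ (m div K) \<le> cover_number (mahavier X G m) (cover_power \<alpha> (m + 1))"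
  shows "ent X G > 0"
proof -
  let ?N = "\<lambda>m. cover_number (mahavier X G m) (cover_power \<alpha> (m + 1))"
  have "ln 2 / (2 * real K) \<le> ent_cover X G \<alpha>"
  proof (rule LIMSEQ_le_const[OF ent_cover_tendsto])
    show "\<exists>N. \<forall>m\<ge>N. ln 2 / (2 * real K) \<le> 1 / real m * log0 (?N m)"
    proof (intro exI allI impI)
      fix m assume m: "m \<ge> K"
      then have "m div K \<ge> 1" using \<open>K > 0\<close> by (simp add: Suc_leI div_greater_zero_iff)
      have "m \<le> K * (m div K) + K"
        using \<open>K > 0\<close> mod_less_divisor[of K m] mult_div_mod_eq[of K m] by linarith
      also have "\<dots> \<le> 2 * K * (m div K)"
        using mult_le_mono2[OF \<open>m div K \<ge> 1\<close>, of K] by simp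
      finally have "real m \<le> 2 * real K * real (m div K)"
        by (metis of_nat_mono of_nat_mult of_nat_numeral)
      then have "ln 2 * real m \<le> ln 2 * (2 * real K * real (m div K))"
        by (intro mult_left_mono) auto
      then have "ln 2 / (2 * real K) \<le> 1 / real m * (real (m div K) * ln 2)"
        using m \<open>K > 0\<close> by (simp add: field_simps)
      also have "real (m div K) * ln 2 = log0 (2 ^ (m div K))"
        by (simp add: log0_def ln_realpow)
      also have "1 / real m * \<dots> \<le> 1 / real m * log0 (?N m)"
        using log0_mono[OF growth[of m]] by (intro mult_left_mono) auto
      finally show "ln 2 / (2 * real K) \<le> 1 / real m * log0 (?N m)" .
    qed
  qed (use assms in \<open>auto simp: open_cover_def\<close>)
  moreover have "0 < ln 2 / (2 * real K)" using \<open>K > 0\<close> by simp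
  ultimately have "0 < ereal (ent_cover X G \<alpha>)" by simp
  also have "\<dots> \<le> ent X G"
    using assms(1,3) by (auto simp: ent_def intro: SUP_upper)
  finally show ?thesis .
qed

section \<open>The union of two segments through the origin\<close>

definition two_lines :: "real \<Rightarrow> real \<Rightarrow> (real \<times> real) set" where
  "two_lines a b = {(x, y) \<in> {0..1} \<times> {0..1}. y = a * x \<or> y = b * x}"

locale two_slopes =
  fixes a b :: real
  assumes a_gt_1: "1 < a" and b_pos: "0 < b" and ab_less_1: "a * b < 1"
begin

lemma a_pos: "0 < a" and b_less_1: "b < 1"
proof -
  show "0 < a" using a_gt_1 by simp
  have "b \<le> a * b" using a_gt_1 b_pos by simp
  then show "b < 1" using ab_less_1 by simp
qed

lemma two_lines_eq_images:
  "two_lines a b = (\<lambda>x. (x, a * x)) ` {0..1 / a} \<union> (\<lambda>x. (x, b * x)) ` {0..1}"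
proof -
  have upper: "x \<le> 1 / a \<longleftrightarrow> a * x \<le> 1" for x
    using a_pos by (simp add: field_simps)
  have dom: "x \<le> 1" if "0 \<le> x" "a * x \<le> 1" for x
    using that a_gt_1 mult_right_mono[of 1 a x] by simp
  have lower: "b * x \<le> 1" if "0 \<le> x" "x \<le> 1" for x
    using that b_pos b_less_1 by (simp add: mult_le_one)
  have "(x, y) \<in> two_lines a b \<longleftrightarrow>
      (0 \<le> x \<and> x \<le> 1 / a \<and> y = a * x) \<or> (0 \<le> x \<and> x \<le> 1 \<and> y = b * x)" for x y
    using dom[of x] lower[of x] a_pos b_pos unfolding two_lines_def upper by auto
  then show ?thesis by (auto simp: image_iff)
qed

lemma compact_two_lines: "compact (two_lines a b)"
  unfolding two_lines_eq_images
  by (intro compact_Un compact_continuous_image continuous_intros) auto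

lemma subcontinuum_two_lines: "subcontinuum (two_lines a b) ({0..1} \<times> {0..1})"
proof -
  have "connected (two_lines a b)"
    unfolding two_lines_eq_images
  proof (rule connected_Un)
    show "connected ((\<lambda>x. (x, a * x)) ` {0..1 / a})" "connected ((\<lambda>x. (x, b * x)) ` {0..1})"
      by (intro connected_continuous_image continuous_intros; simp)+
    have "(0, 0) \<in> (\<lambda>x. (x, a * x)) ` {0..1 / a} \<inter> (\<lambda>x. (x, b * x)) ` {0..1}"
      using a_pos by force
    then show "(\<lambda>x. (x, a * x)) ` {0..1 / a} \<inter> (\<lambda>x. (x, b * x)) ` {0..1} \<noteq> {}" by blast
  qed
  moreover have "(0, 0) \<in> two_lines a b" by (simp add: two_lines_def)
  moreover have "two_lines a b \<subseteq> {0..1} \<times> {0..1}" by (auto simp: two_lines_def)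
  ultimately show ?thesis
    using compact_two_lines by (auto simp: subcontinuum_def continuum_def)
qed

end

text \<open>
  The points at which \<open>F x \<subseteq> U\<close> fails are the first coordinates of the points of the graph
  outside \<open>X \<times> U\<close>, and projections of compact sets are closed.
\<close>

lemma upper_semicontinuous_if_compact_graph:
  assumes "compact (sv_graph X Y F)" and range: "\<And>x. x \<in> X \<Longrightarrow> F x \<subseteq> Y"
  shows "upper_semicontinuous X Y F"
  unfolding upper_semicontinuous_def
proof (intro ballI allI impI)
  fix x0 U assume x0: "x0 \<in> X" and U: "openin (top_of_set Y) U \<and> F x0 \<subseteq> U"
  then obtain W where W: "open W" "U = Y \<inter> W" by (auto simp: openin_open)
  let ?B = "fst ` (sv_graph X Y F \<inter> (UNIV \<times> (- W)))"
  have "compact (sv_graph X Y F \<inter> (UNIV \<times> (- W)))"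
    using assms(1) W(1) by (intro compact_Int_closed closed_Times) auto
  then have "compact ?B"
    by (rule compact_continuous_image[rotated]) (intro continuous_intros)
  then have "openin (top_of_set X) (X \<inter> - ?B)"
    by (intro openin_open_Int open_Compl compact_imp_closed)
  moreover have "x0 \<in> X \<inter> - ?B"
    using x0 U W(2) by (auto simp: sv_graph_def)
  moreover have "\<forall>x\<in>X \<inter> - ?B. F x \<subseteq> U"
  proof (intro ballI subsetI)
    fix x y assume x: "x \<in> X \<inter> - ?B" and y: "y \<in> F x"
    have "y \<in> Y" using range x y by blast
    then have "(x, y) \<in> sv_graph X Y F" using x y by (simp add: sv_graph_def)
    then have "y \<in> W" using x by (metis ComplD ComplI IntD2 IntI SigmaI UNIV_I fst_conv image_eqI)
    with \<open>y \<in> Y\<close> show "y \<in> U" using W(2) by blast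
  qed
  ultimately show "\<exists>V. openin (top_of_set X) V \<and> x0 \<in> V \<and> (\<forall>x\<in>V. F x \<subseteq> U)"
    by blast
qed

lemma (in two_slopes) two_lines_is_surjective_usc_graph:
  "\<exists>F. F \<in> {0..1} \<rightarrow> hyperspace {0..1} \<and> sv_surjective {0..1} {0..1} F
     \<and> upper_semicontinuous {0..1} {0..1} F \<and> two_lines a b = sv_graph {0..1} {0..1} F"
proof (intro exI conjI)
  let ?F = "\<lambda>x. {y \<in> {0..1}. y = a * x \<or> y = b * x}"
  show graph: "two_lines a b = sv_graph {0..1} {0..1} ?F"
    by (auto simp: two_lines_def sv_graph_def)
  show "upper_semicontinuous {0..1} {0..1} ?F"
    by (rule upper_semicontinuous_if_compact_graph)
      (use compact_two_lines graph in auto)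
  show "?F \<in> {0..1} \<rightarrow> hyperspace {0..1}"
  proof
    fix x :: real assume x: "x \<in> {0..1}"
    have "finite (?F x)" by (rule finite_subset[of _ "{a * x, b * x}"]) auto
    then have "closedin (top_of_set {0..1}) (?F x)"
      by (intro closed_subset finite_imp_closed) auto
    moreover have "b * x \<in> ?F x"
      using x b_pos b_less_1 by (simp add: mult_le_one)
    ultimately show "?F x \<in> hyperspace {0..1}"
      unfolding hyperspace_def by blast
  qed
  show "sv_surjective {0..1} {0..1} ?F"
    unfolding sv_surjective_def
  proof (intro equalityI subsetI)
    fix y :: real assume y: "y \<in> {0..1}"
    then have "y / a \<in> {0..1}" "y \<in> ?F (y / a)"
      using a_gt_1 by auto
    then show "y \<in> (\<Union>x\<in>{0..1}. ?F x)" by blast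
  qed auto
qed

section \<open>An orbit with many independent alternatives\<close>

context two_slopes
begin

primrec orbit :: "nat \<Rightarrow> real" where
  "orbit 0 = 1 / a"
| "orbit (Suc t) = (if orbit t > 1 / a\<^sup>2 then b * orbit t else a * orbit t)"

definition peaks :: "nat set" where
  "peaks = {t. orbit t > 1 / a\<^sup>2}"

lemma b_div_a_less: "b / a < 1 / a\<^sup>2"
  using a_pos ab_less_1 by (simp add: field_simps power2_eq_square)

lemma orbit_le: "orbit t \<le> 1 / a"
proof (induction t)
  case (Suc t)
  have "b * orbit t \<le> orbit t" if "orbit t > 1 / a\<^sup>2"
  proof -
    have "0 < orbit t" using that a_pos by (smt (verit) zero_less_power divide_pos_pos)
    then show ?thesis using b_less_1 by simp
  qed
  moreover have "a * orbit t \<le> 1 / a" if "\<not> orbit t > 1 / a\<^sup>2"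
    using that a_pos by (simp add: field_simps power2_eq_square)
  ultimately show ?case using Suc by auto
qed simp

lemma orbit_ge: "b / a\<^sup>2 \<le> orbit t"
proof (induction t)
  case 0
  have "b / a\<^sup>2 = (b / a) / a" by (simp add: power2_eq_square)
  also have "\<dots> \<le> 1 / a"
    using a_gt_1 b_less_1 b_pos by (intro divide_right_mono) auto
  finally show ?case by simp
next
  case (Suc t)
  have "0 < orbit t" using Suc a_pos b_pos by (smt (verit) zero_less_power divide_pos_pos)
  then have "orbit t \<le> a * orbit t" using a_gt_1 by simp
  moreover have "b / a\<^sup>2 \<le> b * orbit t" if "orbit t > 1 / a\<^sup>2"
    using mult_left_mono[of "1 / a\<^sup>2" "orbit t" b] that b_pos by simp
  ultimately show ?case using Suc by auto
qed

lemma orbit_pos: "0 < orbit t"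
proof -
  have "0 < b / a\<^sup>2" using a_pos b_pos by simp
  then show ?thesis using orbit_ge[of t] by linarith
qed

lemma after_peak:
  assumes "t \<in> peaks"
  shows "orbit (Suc t) = b * orbit t" "orbit (Suc t) \<le> b / a" "Suc t \<notin> peaks"
    "1 / a < a * orbit t" "a * orbit t \<le> 1"
proof -
  from assms have big: "orbit t > 1 / a\<^sup>2" by (simp add: peaks_def)
  then show step: "orbit (Suc t) = b * orbit t" by simp
  show le: "orbit (Suc t) \<le> b / a"
    using mult_left_mono[OF orbit_le[of t], of b] b_pos step by simp
  then have "\<not> orbit (Suc t) > 1 / a\<^sup>2" using b_div_a_less by linarith
  then show "Suc t \<notin> peaks" by (simp add: peaks_def del: orbit.simps)
  show "1 / a < a * orbit t"
    using big a_pos by (simp add: field_simps power2_eq_square)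
  show "a * orbit t \<le> 1"
    using orbit_le[of t] a_pos by (simp add: field_simps)
qed

text \<open>
  Between peaks the orbit grows by the factor \<open>a\<close> at each step, and it is confined to
  \<open>[b/a\<^sup>2, 1/a]\<close>; so \<open>K\<close> only has to satisfy \<open>a\<^sup>K > a/b\<close>, the ratio of these bounds.
\<close>

lemma peaks_syndetic:
  obtains K where "K > 0" "\<And>t. \<exists>s\<in>peaks. t \<le> s \<and> s < t + K"
proof -
  obtain K where K: "a / b < a ^ K"
    using real_arch_pow[OF a_gt_1] by blast
  have "\<exists>s\<in>peaks. t \<le> s \<and> s < t + K" for t
  proof (rule ccontr)
    assume none: "\<not> (\<exists>s\<in>peaks. t \<le> s \<and> s < t + K)"
    have "orbit (t + i) = a ^ i * orbit t" if "i \<le> K" for i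
      using that
    proof (induction i)
      case (Suc i)
      then have "t + i \<notin> peaks" using none by auto
      then show ?case using Suc by (simp add: peaks_def)
    qed simp
    then have "orbit (t + K) = a ^ K * orbit t" by simp
    moreover have "a / b * (b / a\<^sup>2) < a ^ K * (b / a\<^sup>2)"
      using K a_pos b_pos by (intro mult_strict_right_mono) auto
    moreover have "a ^ K * (b / a\<^sup>2) \<le> a ^ K * orbit t"
      using orbit_ge a_pos by (intro mult_left_mono) auto
    moreover have "a / b * (b / a\<^sup>2) = 1 / a"
      using a_pos b_pos by (simp add: power2_eq_square)
    ultimately show False using orbit_le[of "t + K"] by linarith
  qed
  moreover from this[of 0] have "K > 0" by auto
  ultimately show thesis using that by blast
qed

lemma card_peaks_ge:
  assumes "K > 0" "\<And>t. \<exists>s\<in>peaks. t \<le> s \<and> s < t + K"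
  shows "m div K \<le> card (peaks \<inter> {..<m})"
proof -
  have "\<forall>j. \<exists>s\<in>peaks. j * K \<le> s \<and> s < j * K + K" using assms(2) by blast
  then obtain u where u: "\<And>j. u j \<in> peaks \<and> j * K \<le> u j \<and> u j < j * K + K" by metis
  have "u j div K = j" for j
    using u[of j] by (intro div_nat_eqI) (auto simp: algebra_simps)
  then have "inj_on u {..<m div K}" by (metis inj_onI)
  moreover have "u ` {..<m div K} \<subseteq> peaks \<inter> {..<m}"
  proof clarify
    fix j assume "j < m div K"
    then have "Suc j * K \<le> m div K * K" by (intro mult_le_mono1) simp
    also have "\<dots> \<le> m" by simp
    finally show "u j \<in> peaks \<inter> {..<m}" using u[of j] by auto
  qed
  ultimately have "card {..<m div K} \<le> card (peaks \<inter> {..<m})"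
    by (rule card_inj_on_le) simp
  then show ?thesis by simp
qed

text \<open>The orbit with the order of the two multiplications exchanged at the peaks in \<open>S\<close>.\<close>

definition variant :: "nat set \<Rightarrow> nat \<Rightarrow> real" where
  "variant S t = (if t \<in> Suc ` S then a * orbit (t - 1) else orbit t)"

lemma variant_in_unit:
  assumes "S \<subseteq> peaks"
  shows "variant S t \<in> {0..1}"
proof (cases "t \<in> Suc ` S")
  case True
  then obtain s where "t = Suc s" "s \<in> peaks" using assms by auto
  then show ?thesis
    using True after_peak(5)[of s] orbit_pos[of s] a_pos by (simp add: variant_def)
next
  case False
  have "1 / a \<le> 1" using a_gt_1 by simp
  then show ?thesis
    using False orbit_pos[of t] orbit_le[of t] by (simp add: variant_def)
qed

text \<open>
  An exchange at \<open>s\<close> only affects time \<open>s + 1\<close>: both orders lead from \<open>z\<close> at time \<open>s\<close> to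
  \<open>a b z\<close> at time \<open>s + 2\<close>, because the orbit multiplies by \<open>a\<close> right after a peak.
\<close>

lemma variant_Suc:
  assumes "S \<subseteq> peaks"
  shows "variant S (Suc t) = a * variant S t \<or> variant S (Suc t) = b * variant S t"
proof (cases "t \<in> S")
  case True
  \<comment> \<open>two consecutive times are never both peaks, so the orbit is unmodified at time \<open>t\<close>\<close>
  have "t \<notin> Suc ` S" using True assms after_peak(3) by blast
  then show ?thesis using True by (simp add: variant_def)
next
  case not_exchanged: False
  show ?thesis
  proof (cases "t \<in> Suc ` S")
    case True
    then obtain s where s: "t = Suc s" "s \<in> S" by auto
    then have "s \<in> peaks" using assms by auto
    then have "orbit (Suc t) = a * orbit t" "orbit t = b * orbit s"
      using after_peak(1,3)[of s] s(1) by (simp_all add: peaks_def del: orbit.simps)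
        (simp add: peaks_def)
    then show ?thesis
      using s not_exchanged by (auto simp: variant_def simp del: orbit.simps)
  next
    case False
    then show ?thesis using not_exchanged by (auto simp: variant_def)
  qed
qed

lemma reversed_variant_in_mahavier:
  assumes "S \<subseteq> peaks"
  shows "(\<lambda>i\<in>{..<m + 1}. variant S (m - i)) \<in> mahavier {0..1} (two_lines a b) m"
  unfolding mahavier_def
proof (intro CollectI conjI allI impI)
  show "(\<lambda>i\<in>{..<m + 1}. variant S (m - i)) \<in> {..<m + 1} \<rightarrow>\<^sub>E {0..1}"
    using variant_in_unit[OF assms] by auto
  fix i assume "i < m"
  then have "m - i = Suc (m - Suc i)" by simp
  then show "((\<lambda>i\<in>{..<m + 1}. variant S (m - i)) (Suc i),
              (\<lambda>i\<in>{..<m + 1}. variant S (m - i)) i) \<in> two_lines a b"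
    using \<open>i < m\<close> variant_in_unit[OF assms] variant_Suc[OF assms, of "m - Suc i"]
    by (simp add: two_lines_def)
qed

text \<open>
  This cover separates the two possible values just after a peak, one of them being at most
  \<open>b/a\<close> and the other greater than \<open>1/a\<close>.
\<close>

definition separating_cover :: "real set set" where
  "separating_cover = {{0..1} \<inter> {..<1 / a}, {0..1} \<inter> {b / a<..}}"

lemma open_cover_separating_cover: "open_cover {0..1} separating_cover"
proof -
  have "b / a < 1 / a" using a_pos b_less_1 by (simp add: divide_strict_right_mono)
  then show ?thesis
    unfolding open_cover_def separating_cover_def by (auto intro!: openin_open_Int)
qed

text \<open>
  Just after a time in \<open>S - S'\<close> the two orbits take the two alternatives, which no member of the
  cover contains both.
\<close>

lemma box_contains_one_variant:
  assumes B: "B \<in> cover_power separating_cover (m + 1)"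
    and S: "S \<subseteq> peaks \<inter> {..<m}" and S': "S' \<subseteq> peaks \<inter> {..<m}"
    and mem: "(\<lambda>i\<in>{..<m + 1}. variant S (m - i)) \<in> B"
    and mem': "(\<lambda>i\<in>{..<m + 1}. variant S' (m - i)) \<in> B"
  shows "S \<subseteq> S'"
proof (rule ccontr)
  assume "\<not> S \<subseteq> S'"
  then obtain t where t: "t \<in> S" "t \<notin> S'" by blast
  then have "t \<in> peaks" "t < m" using S by auto
  obtain A where A: "B = Pi\<^sub>E {..<m + 1} A" "\<forall>j<m + 1. A j \<in> separating_cover"
    using B unfolding cover_power_def by blast
  let ?i = "m - Suc t"
  have i: "?i < m + 1" "m - ?i = Suc t" using \<open>t < m\<close> by auto
  have "variant S (Suc t) \<in> A ?i" "variant S' (Suc t) \<in> A ?i"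
    using PiE_mem[OF mem[unfolded A(1)], of ?i] PiE_mem[OF mem'[unfolded A(1)], of ?i] i
    by simp_all
  moreover have "variant S (Suc t) = a * orbit t" "variant S' (Suc t) = orbit (Suc t)"
    using t by (auto simp: variant_def simp del: orbit.simps)
  ultimately have "a * orbit t \<in> A ?i" "orbit (Suc t) \<in> A ?i" by metis+
  moreover have "a * orbit t \<notin> {0..1} \<inter> {..<1 / a}" "orbit (Suc t) \<notin> {0..1} \<inter> {b / a<..}"
    using after_peak(2,4)[OF \<open>t \<in> peaks\<close>] by (simp_all del: orbit.simps)
  moreover have "A ?i \<in> separating_cover" using A(2) i(1) by blast
  ultimately show False unfolding separating_cover_def by (metis insertE singletonD)
qed

lemma ent_two_lines_pos: "ent {0..1} (two_lines a b) > 0"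
proof -
  obtain K where K: "K > 0" "\<And>t. \<exists>s\<in>peaks. t \<le> s \<and> s < t + K"
    by (rule peaks_syndetic) blast
  have fin: "finite separating_cover" by (simp add: separating_cover_def)
  show ?thesis
  proof (rule ent_pos_if_exponential_growth[OF open_cover_separating_cover fin _ K(1)])
    show "two_lines a b \<noteq> {}"
      using subcontinuum_two_lines by (simp add: subcontinuum_def continuum_def)
    fix m
    let ?P = "Pow (peaks \<inter> {..<m})"
    have "2 ^ (m div K) \<le> (2::nat) ^ card (peaks \<inter> {..<m})"
      using card_peaks_ge[OF K] by (intro power_increasing) auto
    also have "\<dots> = card ?P" by (rule card_Pow[symmetric]) simp
    also have "\<dots> \<le> cover_number (mahavier {0..1} (two_lines a b) m)
        (cover_power separating_cover (m + 1))"
    proof (rule card_le_cover_number)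
      show "mahavier {0..1} (two_lines a b) m \<subseteq> \<Union>(cover_power separating_cover (m + 1))"
        using open_cover_separating_cover
        by (intro mahavier_subset_Union_cover_power) (simp add: open_cover_def)
      show "(\<lambda>i\<in>{..<m + 1}. variant S (m - i)) \<in> mahavier {0..1} (two_lines a b) m"
        if "S \<in> ?P" for S
        using that by (intro reversed_variant_in_mahavier) auto
      show "S = S'" if "B \<in> cover_power separating_cover (m + 1)" "S \<in> ?P" "S' \<in> ?P"
        "(\<lambda>i\<in>{..<m + 1}. variant S (m - i)) \<in> B"
        "(\<lambda>i\<in>{..<m + 1}. variant S' (m - i)) \<in> B" for B S S'
        using box_contains_one_variant[OF that(1)] that by (metis PowD subset_antisym)
    qed (rule finite_cover_power[OF fin])
    finally show "2 ^ (m div K) \<le> cover_number (mahavier {0..1} (two_lines a b) m)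
        (cover_power separating_cover (m + 1))" .
  qed
qed

end

section \<open>Periodic points\<close>

lemma funpow_shift: "(shift ^^ n) x = (\<lambda>i. x (i + n))"
  by (induction n) (simp_all add: shift_def fun_eq_iff)

lemma mahavier_inf_two_lines_step:
  assumes "x \<in> mahavier_inf {0..1} (two_lines a b)"
  shows "x i = a * x (Suc i) \<or> x i = b * x (Suc i)"
  using assms by (auto simp: mahavier_inf_def two_lines_def)

lemma mahavier_inf_two_lines_power:
  assumes "x \<in> mahavier_inf {0..1} (two_lines a b)"
  shows "\<exists>k l. k + l = n \<and> x i = a ^ k * b ^ l * x (i + n)"
proof (induction n)
  case (Suc n)
  then obtain k l where "k + l = n" "x i = a ^ k * b ^ l * x (i + n)" by blast
  with mahavier_inf_two_lines_step[OF assms, of "i + n"] consider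
    "Suc k + l = Suc n" "x i = a ^ Suc k * b ^ l * x (i + Suc n)" |
    "k + Suc l = Suc n" "x i = a ^ k * b ^ Suc l * x (i + Suc n)"
    by (auto simp: algebra_simps)
  then show ?case by cases blast+
qed simp

lemma (in two_slopes) periodic_point_two_lines_iff:
  assumes irrational: "\<And>k::nat. k > 0 \<Longrightarrow> a ^ k \<notin> \<rat>" and "b \<in> \<rat>"
  shows "periodic_point {0..1} (two_lines a b) x \<longleftrightarrow> x = (\<lambda>_. 0)"
proof
  assume "periodic_point {0..1} (two_lines a b) x"
  then obtain n where x: "x \<in> mahavier_inf {0..1} (two_lines a b)"
    and n: "n > 0" "(shift ^^ n) x = x"
    by (auto simp: periodic_point_def)
  show "x = (\<lambda>_. 0)"
  proof
    fix i
    obtain k l where kl: "k + l = n" "x i = a ^ k * b ^ l * x (i + n)"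
      using mahavier_inf_two_lines_power[OF x] by blast
    have "x (i + n) = x i" using n(2) unfolding funpow_shift by (rule fun_cong)
    then have fixed: "x i = a ^ k * b ^ l * x i" using kl(2) by simp
    show "x i = 0"
    proof (rule ccontr)
      assume "x i \<noteq> 0"
      then have one: "a ^ k * b ^ l = 1" using fixed by simp
      have "k > 0"
      proof (rule ccontr)
        assume "\<not> k > 0"
        then have "b ^ l = 1" "l > 0" using one kl(1) n(1) by auto
        then show False using power_Suc_less_one[OF b_pos b_less_1, of "l - 1"] by simp
      qed
      moreover have "a ^ k = 1 / b ^ l" using one b_pos by (simp add: field_simps)
      then have "a ^ k \<in> \<rat>" using \<open>b \<in> \<rat>\<close> by simp
      ultimately show False using irrational by blast
    qed
  qed
next
  assume "x = (\<lambda>_. 0)"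
  then have "x \<in> mahavier_inf {0..1} (two_lines a b)" "(shift ^^ 1) x = x"
    by (auto simp: mahavier_inf_def two_lines_def shift_def)
  then show "periodic_point {0..1} (two_lines a b) x"
    unfolding periodic_point_def by (metis zero_less_one)
qed

theorem theorem7p4:
  fixes a b :: real and I :: "real set" and H :: "(real \<times> real) set"
  assumes "I = {0..1}"
    and "a > 1" and "a \<notin> \<rat>" and "\<And>k::nat. k > 0 \<Longrightarrow> a ^ k \<notin> \<rat>"
    and "0 < b" and "b < 1" and "b \<in> \<rat>" and "1 / a > b"
    and "H = {(x, y) \<in> I \<times> I. y = a * x \<or> y = b * x}"
  shows "(\<exists>F. F \<in> I \<rightarrow> hyperspace I \<and> sv_surjective I I F \<and> upper_semicontinuous I I F
            \<and> H = sv_graph I I F)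
       \<and> subcontinuum H (I \<times> I)
       \<and> almost_i_embedded I H"
proof -
  interpret two_slopes a b
    by unfold_locales (use assms(2,5,8) in \<open>auto simp: field_simps\<close>)
  have H: "H = two_lines a b" using assms(1,9) by (simp add: two_lines_def)
  have "closed_relation I H"
    using compact_two_lines subcontinuum_two_lines assms(1) H
    by (auto simp: closed_relation_def subcontinuum_def intro!: closed_subset compact_imp_closed)
  moreover have "\<exists>!x. periodic_point I H x"
    using periodic_point_two_lines_iff[OF assms(4,7)] assms(1) H by simp
  ultimately have "almost_i_embedded I H"
    using ent_two_lines_pos assms(1) H by (simp add: almost_i_embedded_def)
  then show ?thesis
    using two_lines_is_surjective_usc_graph subcontinuum_two_lines assms(1) H by simp
qed

end
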